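(* Let $K$ be a compact Hausdorff space and $V(K)=C(K)\hat{\otimes}C(K)$. The closed subalgebra of $V(K)$ generated by all functions $(x,y)\mapsto f(x)-f(y)$, $f\in C(K)$, coincides with the ideal of all functions in $V(K)$ vanishing on the diagonal, that is, with $\{F\in V(K): F(x,x)=0 \text{ for all } x\in K\}$.
   Context: $C(K)$ is the Banach algebra of continuous complex functions on $K$, and $\hat{\otimes}$ is the projective tensor product of Banach spaces. $V(K)$ (the Varopoulos algebra) is a Banach algebra with its projective norm and is realized as an algebra of functions on $K\times K$ by sending $\sum_n a_n\otimes b_n$ to $F(x,y)=\sum_n a_n(x)b_n(y)$. Closures are taken in the norm of $V(K)$; the generated algebra is not required to contain the unit. *)

theory Defs
  imports "HOL-Analysis.Analysis"
begin

text \<open>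
  A compact Hausdorff space \<open>K\<close> is a type \<open>'k::t2_space\<close> with \<open>compact (UNIV :: 'k set)\<close>; then
  \<open>'k \<Rightarrow>\<^sub>C complex\<close> is \<open>C(K)\<close> with the supremum norm.

  Every element of the projective tensor product of Banach spaces \<open>X\<close>, \<open>Y\<close> is a sum of a series of
  elementary tensors \<open>a n \<otimes> b n\<close> with \<open>\<Sum>n. norm (a n) * norm (b n) < \<infinity>\<close>, and its projective norm is
  the infimum of these sums over all such series representing it.  Two series represent the same
  tensor iff every bounded bilinear form takes the same value on them.  For \<open>X = Y = C(K)\<close> this
  happens iff they define the same function on \<open>K \<times> K\<close> (lemma \<open>tensor_rep_unique\<close> below), so that
  the projective tensor product is faithfully realized as an algebra of functions with pointwise
  operations and the infimum may be taken over all series representing a given function.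
\<close>

definition tensor_rep ::
  "(nat \<Rightarrow> 'k::t2_space \<Rightarrow>\<^sub>C complex) \<Rightarrow> (nat \<Rightarrow> 'k \<Rightarrow>\<^sub>C complex) \<Rightarrow> ('k \<times> 'k \<Rightarrow> complex) \<Rightarrow> bool"
  where "tensor_rep a b F \<longleftrightarrow>
    summable (\<lambda>n. norm (a n) * norm (b n)) \<and>
    (\<forall>x y. (\<lambda>n. apply_bcontfun (a n) x * apply_bcontfun (b n) y) sums F (x, y))"

definition varopoulos :: "('k::t2_space \<times> 'k \<Rightarrow> complex) set"
  where "varopoulos = {F. \<exists>a b. tensor_rep a b F}"

definition varopoulos_norm :: "('k::t2_space \<times> 'k \<Rightarrow> complex) \<Rightarrow> real"
  where "varopoulos_norm F = Inf {\<Sum>n. norm (a n) * norm (b n) | a b. tensor_rep a b F}"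

text \<open>Subalgebras are complex subalgebras, not required to contain the constant function 1.\<close>

definition varopoulos_closed_subalgebra :: "('k::t2_space \<times> 'k \<Rightarrow> complex) set \<Rightarrow> bool"
  where "varopoulos_closed_subalgebra A \<longleftrightarrow>
    A \<subseteq> varopoulos \<and>
    (\<lambda>p. 0) \<in> A \<and>
    (\<forall>F\<in>A. \<forall>G\<in>A. (\<lambda>p. F p + G p) \<in> A) \<and>
    (\<forall>c. \<forall>F\<in>A. (\<lambda>p. c * F p) \<in> A) \<and>
    (\<forall>F\<in>A. \<forall>G\<in>A. (\<lambda>p. F p * G p) \<in> A) \<and>
    (\<forall>F\<in>varopoulos. (\<forall>e>0. \<exists>G\<in>A. varopoulos_norm (\<lambda>p. F p - G p) < e) \<longrightarrow> F \<in> A)"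

definition difference_fun :: "('k::t2_space \<Rightarrow>\<^sub>C complex) \<Rightarrow> 'k \<times> 'k \<Rightarrow> complex"
  where "difference_fun f = (\<lambda>(x, y). apply_bcontfun f x - apply_bcontfun f y)"

lemma finite_rank_approximation:
  fixes S :: "('k::t2_space \<Rightarrow>\<^sub>C complex) set"
  assumes K: "compact (UNIV :: 'k set)" and S: "finite S" and e: "e > 0"
  obtains X :: "'k set" and p :: "'k \<Rightarrow> 'k \<Rightarrow>\<^sub>C complex"
  where "finite X"
    "\<And>f y. f \<in> S \<Longrightarrow> norm (f y - (\<Sum>x\<in>X. f x * p x y)) \<le> e"
    "\<And>f y. norm (\<Sum>x\<in>X. apply_bcontfun f x * p x y) \<le> norm f"
proof -
  define d :: "'k \<Rightarrow> 'k \<Rightarrow> real" where "d x y = (\<Sum>f\<in>S. norm (apply_bcontfun f y - f x))" for x y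
  have d_cont: "continuous_on UNIV (d x)" for x
    unfolding d_def by (intro continuous_intros) auto
  have d_open: "open {y. d x y < e}" for x
    by (rule open_Collect_less[OF d_cont continuous_on_const])
  have d_self: "d x x = 0" for x by (simp add: d_def)
  have "\<exists>X\<subseteq>UNIV. finite X \<and> UNIV \<subseteq> (\<Union>x\<in>X. {y. d x y < e})"
    using compactE_image[OF K, of UNIV "\<lambda>x. {y. d x y < e}"] d_open d_self e
    by (metis (mono_tags, lifting) UNIV_I UN_iff mem_Collect_eq subsetI)
  then obtain X where X: "finite X" "\<And>y. \<exists>x\<in>X. d x y < e" by blast
  define w :: "'k \<Rightarrow> 'k \<Rightarrow> real" where "w x y = max 0 (e - d x y)" for x y
  define W where "W y = (\<Sum>x\<in>X. w x y)" for y
  have w_nonneg: "w x y \<ge> 0" for x y by (simp add: w_def)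
  have W_pos: "W y > 0" for y
  proof -
    obtain x where "x \<in> X" "d x y < e" using X(2) by blast
    then have "w x y > 0" by (simp add: w_def)
    with \<open>x \<in> X\<close> show ?thesis unfolding W_def using X(1) w_nonneg by (metis sum_pos2)
  qed
  have w_cont: "continuous_on UNIV (w x)" for x
    unfolding w_def by (intro continuous_intros d_cont)
  have W_cont: "continuous_on UNIV W"
    unfolding W_def by (intro continuous_intros w_cont)
  define q where "q x y = complex_of_real (w x y / W y)" for x y
  have q_cont: "continuous_on UNIV (q x)" for x
    unfolding q_def using W_pos
    by (intro continuous_intros w_cont W_cont) (metis less_irrefl)
  have "q x \<in> bcontfun" for x
    unfolding bcontfun_def
    using q_cont K by (auto intro: compact_imp_bounded compact_continuous_image)
  then have p: "apply_bcontfun (Bcontfun (q x)) = q x" for x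
    by (simp add: Bcontfun_inverse)
  have w_sum: "(\<Sum>x\<in>X. w x y / W y) = 1" for y
    using W_pos[of y] by (simp add: W_def flip: sum_divide_distrib)
  have norm_q: "norm (q x y) = w x y / W y" for x y
    unfolding q_def norm_of_real using w_nonneg[of x y] W_pos[of y] by simp
  have avg: "norm (\<Sum>x\<in>X. c x * q x y) \<le> B"
    if "\<And>x. x \<in> X \<Longrightarrow> w x y \<noteq> 0 \<Longrightarrow> norm (c x) \<le> B" for c B y
  proof -
    have "norm (\<Sum>x\<in>X. c x * q x y) \<le> (\<Sum>x\<in>X. B * (w x y / W y))"
    proof (rule sum_norm_le)
      fix x assume x: "x \<in> X"
      show "norm (c x * q x y) \<le> B * (w x y / W y)"
      proof (cases "w x y = 0")
        case True
        then show ?thesis by (simp add: norm_mult norm_q)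
      next
        case False
        then show ?thesis
          using that[OF x] w_nonneg[of x y] W_pos[of y]
          unfolding norm_mult norm_q by (intro mult_right_mono) auto
      qed
    qed
    also have "\<dots> = B" using w_sum[of y] by (simp only: mult_1_right flip: sum_distrib_left)
    finally show ?thesis .
  qed
  have q_sum: "(\<Sum>x\<in>X. q x y) = 1" for y
    unfolding q_def using w_sum[of y] by (simp only: of_real_sum[symmetric] of_real_1)
  show ?thesis
  proof (rule that[of X "\<lambda>x. Bcontfun (q x)"])
    fix f y assume f: "f \<in> S"
    have "f y - (\<Sum>x\<in>X. f x * q x y) = (\<Sum>x\<in>X. (f y - f x) * q x y)"
      using q_sum[of y] by (simp add: left_diff_distrib sum_subtractf flip: sum_distrib_left)
    also have "norm \<dots> \<le> e"
    proof (rule avg)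
      fix x assume "w x y \<noteq> 0"
      then have "d x y < e" by (auto simp: w_def)
      moreover have "norm (f y - f x) \<le> d x y"
        unfolding d_def by (rule member_le_sum[OF f]) (use S in auto)
      ultimately show "norm (f y - f x) \<le> e" by simp
    qed
    finally show "norm (f y - (\<Sum>x\<in>X. f x * apply_bcontfun (Bcontfun (q x)) y)) \<le> e"
      by (simp add: p)
  next
    show "norm (\<Sum>x\<in>X. apply_bcontfun f x * apply_bcontfun (Bcontfun (q x)) y) \<le> norm f" for f y
      unfolding p by (rule avg) (rule norm_bounded)
  qed (fact X(1))
qed

lemma tensor_rep_bilinear_slice:
  fixes \<phi> :: "('k::t2_space \<Rightarrow>\<^sub>C complex) \<Rightarrow> ('k \<Rightarrow>\<^sub>C complex) \<Rightarrow> complex"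
  assumes phi: "bounded_bilinear \<phi>"
    and right: "\<And>c f g g'. (\<And>x. apply_bcontfun g' x = c * apply_bcontfun g x) \<Longrightarrow> \<phi> f g' = c * \<phi> f g"
    and rep: "tensor_rep a b F"
  obtains G where "apply_bcontfun G = (\<lambda>y. F (x, y))" "\<And>f. (\<lambda>n. apply_bcontfun (a n) x * \<phi> f (b n)) sums \<phi> f G"
proof -
  have sm: "summable (\<lambda>n. norm (a n) * norm (b n))"
    and F: "\<And>y. (\<lambda>n. apply_bcontfun (a n) x * b n y) sums F (x, y)"
    using rep by (auto simp: tensor_rep_def)
  have "\<exists>h :: 'k \<Rightarrow>\<^sub>C complex. \<forall>y. apply_bcontfun h y = a n x * b n y" for n
  proof -
    have "(\<lambda>y. a n x * b n y) \<in> bcontfun"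
      by (rule bcontfun_normI[where b = "norm (a n) * norm (b n)"])
        (auto intro!: continuous_intros mult_mono norm_bounded simp: norm_mult)
    then show ?thesis by (metis Bcontfun_inverse)
  qed
  then obtain h :: "nat \<Rightarrow> 'k \<Rightarrow>\<^sub>C complex" where h: "\<And>n y. apply_bcontfun (h n) y = a n x * b n y" by metis
  have part: "apply_bcontfun (\<Sum>n<N. h n) y = (\<Sum>n<N. a n x * b n y)" for N y
    by (induction N) (auto simp: h)
  have "uniform_limit UNIV (\<lambda>N y. \<Sum>n<N. a n x * b n y) (\<lambda>y. \<Sum>n. a n x * b n y) sequentially"
    by (rule Weierstrass_m_test[OF _ sm]) (auto intro!: mult_mono norm_bounded simp: norm_mult)
  also have "(\<lambda>y. \<Sum>n. a n x * b n y) = (\<lambda>y. F (x, y))"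
    using F by (auto simp: sums_iff)
  also have "(\<lambda>N y. \<Sum>n<N. a n x * b n y) = (\<lambda>N. apply_bcontfun (\<Sum>n<N. h n))"
    by (intro ext) (simp add: part)
  finally obtain G where G: "(\<lambda>y. F (x, y)) = apply_bcontfun G" "(\<lambda>N. \<Sum>n<N. h n) \<longlonglongrightarrow> G"
    by (rule uniform_limit_bcontfunE) auto
  have "(\<lambda>n. apply_bcontfun (a n) x * \<phi> f (b n)) sums \<phi> f G" for f
  proof -
    interpret bounded_linear "\<phi> f" by (rule bounded_bilinear.bounded_linear_right[OF phi])
    have "(\<lambda>n. \<phi> f (h n)) sums \<phi> f G"
      using G(2) by (intro sums) (simp add: sums_def)
    then show ?thesis using right[OF h] by simp
  qed
  with G(1) show ?thesis by (intro that[of G]) auto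
qed

text \<open>
  Representations of the same function represent the same element of the projective tensor
  product.  The two homogeneity assumptions make \<open>\<phi>\<close> complex bilinear.
\<close>

lemma tensor_rep_unique:
  fixes \<phi> :: "('k::t2_space \<Rightarrow>\<^sub>C complex) \<Rightarrow> ('k \<Rightarrow>\<^sub>C complex) \<Rightarrow> complex"
  assumes K: "compact (UNIV :: 'k set)"
    and phi: "bounded_bilinear \<phi>"
    and left: "\<And>c f f' g. (\<And>x. apply_bcontfun f' x = c * apply_bcontfun f x) \<Longrightarrow> \<phi> f' g = c * \<phi> f g"
    and right: "\<And>c f g g'. (\<And>x. apply_bcontfun g' x = c * apply_bcontfun g x) \<Longrightarrow> \<phi> f g' = c * \<phi> f g"
    and rep: "tensor_rep a b F" and rep': "tensor_rep a' b' F"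
  shows "(\<Sum>n. \<phi> (a n) (b n)) = (\<Sum>n. \<phi> (a' n) (b' n))"
proof -
  interpret phi: bounded_bilinear \<phi> by (rule phi)
  obtain B where B: "B > 0" "\<And>f g. norm (\<phi> f g) \<le> norm f * norm g * B"
    using phi.pos_bounded by blast
  define S where "S k = a ` {..k} \<union> a' ` {..k}" for k :: nat
  have "\<exists>X p. finite X \<and>
      (\<forall>f\<in>S k. \<forall>y. norm (f y - (\<Sum>x\<in>X. f x * apply_bcontfun (p x) y)) \<le> inverse (real (Suc k))) \<and>
      (\<forall>f y. norm (\<Sum>x\<in>X. apply_bcontfun f x * apply_bcontfun (p x) y) \<le> norm f)" (is "\<exists>X p. ?Q k X p") for k
  proof -
    have "finite (S k)" "inverse (real (Suc k)) > 0" by (auto simp: S_def)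
    then obtain X p where "finite X"
      "\<And>f y. f \<in> S k \<Longrightarrow> norm (f y - (\<Sum>x\<in>X. f x * apply_bcontfun (p x) y)) \<le> inverse (real (Suc k))"
      "\<And>f y. norm (\<Sum>x\<in>X. apply_bcontfun f x * apply_bcontfun (p x) y) \<le> norm f"
      using finite_rank_approximation[OF K, of "S k" "inverse (real (Suc k))"] by blast
    then show ?thesis by (intro exI[of _ X] exI[of _ p]) simp
  qed
  then obtain X and p :: "nat \<Rightarrow> 'k \<Rightarrow> 'k \<Rightarrow>\<^sub>C complex" where X: "\<And>k. finite (X k)"
    and approx: "\<And>k f y. f \<in> S k \<Longrightarrow>
      norm (f y - (\<Sum>x\<in>X k. f x * apply_bcontfun (p k x) y)) \<le> inverse (real (Suc k))"
    and contr: "\<And>k f y. norm (\<Sum>x\<in>X k. apply_bcontfun f x * apply_bcontfun (p k x) y) \<le> norm f"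
  proof -
    have "\<forall>k. \<exists>Xp. ?Q k (fst Xp) (snd Xp)" using \<open>\<And>k. \<exists>X p. ?Q k X p\<close> by simp
    then obtain Xp where "\<forall>k. ?Q k (fst (Xp k)) (snd (Xp k))" by (rule choice[THEN exE])
    then show ?thesis by (intro that[of "\<lambda>k. fst (Xp k)" "\<lambda>k. snd (Xp k)"]) blast+
  qed
  have "\<exists>h :: 'k \<Rightarrow>\<^sub>C complex. \<forall>y. apply_bcontfun h y = c * apply_bcontfun f y" for c f
  proof -
    have "(\<lambda>y. c * apply_bcontfun f y) \<in> bcontfun"
      by (rule bcontfun_normI[where b = "norm c * norm f"])
        (auto intro!: continuous_intros mult_mono norm_bounded simp: norm_mult)
    then show ?thesis by (metis Bcontfun_inverse)
  qed
  then obtain sc :: "complex \<Rightarrow> ('k \<Rightarrow>\<^sub>C complex) \<Rightarrow> ('k \<Rightarrow>\<^sub>C complex)"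
    where sc: "\<And>c f y. apply_bcontfun (sc c f) y = c * apply_bcontfun f y" by metis
  define T where "T k f = (\<Sum>x\<in>X k. sc (apply_bcontfun f x) (p k x))" for k f
  have apply_sum: "apply_bcontfun (sum g Y) y = (\<Sum>x\<in>Y. apply_bcontfun (g x) y)"
    for g :: "'k \<Rightarrow> 'k \<Rightarrow>\<^sub>C complex" and Y y
    by (induction Y rule: infinite_finite_induct) auto
  have T: "apply_bcontfun (T k f) y = (\<Sum>x\<in>X k. apply_bcontfun f x * apply_bcontfun (p k x) y)" for k f y
    unfolding T_def by (simp add: apply_sum sc)
  have T_le: "norm (T k f) \<le> norm f" for k f
    by (rule norm_bound) (simp add: T contr)
  have T_near: "norm (f - T k f) \<le> inverse (real (Suc k))" if "f \<in> S k" for k f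
    by (rule norm_bound) (simp add: T approx[OF that] del: of_nat_Suc)
  have phi_T: "\<phi> (T k f) g = (\<Sum>x\<in>X k. apply_bcontfun f x * \<phi> (p k x) g)" for k f g
    unfolding T_def phi.sum_left by (intro sum.cong refl left sc)
  have lim: "(\<lambda>k. \<Sum>n. \<phi> (T k (u n)) (v n)) \<longlonglongrightarrow> (\<Sum>n. \<phi> (u n) (v n))"
    if uS: "\<And>k. u ` {..k} \<subseteq> S k" and uv: "tensor_rep u v F" for u v
  proof (rule tannerys_theorem[where M = "\<lambda>n. norm (u n) * norm (v n) * B",
        THEN conjunct2, THEN conjunct2])
    fix n
    have "(\<lambda>k. T k (u n)) \<longlonglongrightarrow> u n"
    proof (rule metric_tendsto_imp_tendsto[OF LIMSEQ_inverse_real_of_nat])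
      show "\<forall>\<^sub>F k in sequentially. dist (T k (u n)) (u n) \<le> dist (inverse (real (Suc k))) 0"
        using eventually_ge_at_top[of n]
      proof eventually_elim
        case (elim k)
        then have "u n \<in> S k" using uS[of k] by auto
        from T_near[OF this] show ?case by (simp add: dist_norm norm_minus_commute)
      qed
    qed
    then show "(\<lambda>k. \<phi> (T k (u n)) (v n)) \<longlonglongrightarrow> \<phi> (u n) (v n)"
      by (intro phi.tendsto tendsto_const)
  next
    show "\<forall>\<^sub>F (n, k) in at_top \<times>\<^sub>F sequentially. norm (\<phi> (T k (u n)) (v n)) \<le> norm (u n) * norm (v n) * B"
    proof (intro always_eventually allI, clarify)
      fix n k
      have "norm (\<phi> (T k (u n)) (v n)) \<le> norm (T k (u n)) * norm (v n) * B" by (rule B)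
      also have "\<dots> \<le> norm (u n) * norm (v n) * B"
        using B(1) T_le by (intro mult_right_mono) auto
      finally show "norm (\<phi> (T k (u n)) (v n)) \<le> norm (u n) * norm (v n) * B" .
    qed
  next
    show "summable (\<lambda>n. norm (u n) * norm (v n) * B)"
      using uv by (auto simp: tensor_rep_def intro: summable_mult2)
  qed auto
  have "\<exists>G. apply_bcontfun G = (\<lambda>y. F (x, y))" for x
    using tensor_rep_bilinear_slice[OF phi right rep] by metis
  then obtain G where G: "\<And>x. apply_bcontfun (G x) = (\<lambda>y. F (x, y))" by metis
  have eq: "(\<Sum>n. \<phi> (T k (u n)) (v n)) = (\<Sum>x\<in>X k. \<phi> (p k x) (G x))"
    if uv: "tensor_rep u v F" for u v k
  proof -
    have "(\<lambda>n. apply_bcontfun (u n) x * \<phi> f (v n)) sums \<phi> f (G x)" for x f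
    proof -
      obtain G' where "apply_bcontfun G' = (\<lambda>y. F (x, y))"
        and G': "\<And>f. (\<lambda>n. apply_bcontfun (u n) x * \<phi> f (v n)) sums \<phi> f G'"
        using tensor_rep_bilinear_slice[OF phi right uv] by metis
      then have "G' = G x" by (intro bcontfun_eqI) (simp add: G)
      with G' show ?thesis by simp
    qed
    then have "(\<lambda>n. \<Sum>x\<in>X k. apply_bcontfun (u n) x * \<phi> (p k x) (v n)) sums (\<Sum>x\<in>X k. \<phi> (p k x) (G x))"
      by (intro sums_sum)
    then show ?thesis by (simp add: phi_T sums_iff)
  qed
  have "(\<lambda>k. \<Sum>x\<in>X k. \<phi> (p k x) (G x)) \<longlonglongrightarrow> (\<Sum>n. \<phi> (a n) (b n))"
    using lim[OF _ rep] by (simp add: eq[OF rep] S_def)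
  moreover have "(\<lambda>k. \<Sum>x\<in>X k. \<phi> (p k x) (G x)) \<longlonglongrightarrow> (\<Sum>n. \<phi> (a' n) (b' n))"
    using lim[OF _ rep'] by (simp add: eq[OF rep'] S_def)
  ultimately show ?thesis by (rule LIMSEQ_unique)
qed

end

(*
  Write d f = f (x) 1 - 1 (x) f, with (x) the tensor sign.  A function vanishing on the diagonal
  that is represented by the sum of the a n (x) b n equals the sum of the d (a n) * (1 (x) b n),
  so it suffices to show that a closed subalgebra A containing all d f contains d f * (1 (x) g).
  Since d (f g) - d f * d g = d f * (1 (x) g) + d g * (1 (x) f), polarizing the products of these
  symmetric elements with the d h gives d f * d h * (1 (x) g) in A.  If w is unimodular, the
  powers of z = w (x) cnj w have norm at most 1 and (1 - z) (1 + z + ... + z^(N-1)) = 1 - z^N, so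
  averaging the elements d w * (1 - z^k) * (1 (x) g) of A over k < N gives d w * (1 (x) g) up to
  O(1/N).  Finally every bounded continuous function is a linear combination of unimodular ones.
*)

theory Submission
  imports Defs
begin

text \<open>A bound on the projective norm witnessed by a single series. Working with witnesses
  keeps the infimum out of all estimates and carries membership in \<open>varopoulos\<close> along
  with each bound.\<close>

definition tensor_bound :: "('k::t2_space \<times> 'k \<Rightarrow> complex) \<Rightarrow> real \<Rightarrow> bool"
  where "tensor_bound F s \<longleftrightarrow> (\<exists>a b. tensor_rep a b F \<and> (\<Sum>n. norm (a n) * norm (b n)) \<le> s)"

section \<open>Bounded continuous functions\<close>

lemma bcontfun_continuous: "f \<in> bcontfun \<Longrightarrow> continuous_on S f"
  by (auto simp: bcontfun_def intro: continuous_on_subset)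

lemma bcontfun_bounded:
  fixes f :: "'k::topological_space \<Rightarrow> complex"
  assumes "f \<in> bcontfun"
  shows "\<exists>B>0. \<forall>x. norm (f x) \<le> B"
proof -
  have "bounded (range f)" using assms by (simp add: bcontfun_def)
  then show ?thesis unfolding bounded_pos by blast
qed

lemma bcontfun_mult:
  fixes f g :: "'k::topological_space \<Rightarrow> complex"
  assumes "f \<in> bcontfun" "g \<in> bcontfun"
  shows "(\<lambda>x. f x * g x) \<in> bcontfun"
proof -
  obtain B where "B > 0" "\<And>x. norm (f x) \<le> B" using bcontfun_bounded[OF assms(1)] by blast
  moreover obtain C where "C > 0" "\<And>x. norm (g x) \<le> C" using bcontfun_bounded[OF assms(2)] by blast
  ultimately have "norm (f x * g x) \<le> B * C" for x
    unfolding norm_mult by (intro mult_mono) (auto intro: less_imp_le)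
  then show ?thesis
    by (rule bcontfun_normI[OF continuous_on_mult[OF bcontfun_continuous bcontfun_continuous], OF assms])
qed

lemma bcontfun_power:
  fixes f :: "'k::topological_space \<Rightarrow> complex"
  shows "f \<in> bcontfun \<Longrightarrow> (\<lambda>x. f x ^ n) \<in> bcontfun"
  by (induction n) (auto intro: const_bcontfun bcontfun_mult)

lemma bcontfun_bounded_linear:
  fixes f :: "'k::topological_space \<Rightarrow> complex" and T :: "complex \<Rightarrow> complex"
  assumes "f \<in> bcontfun" "bounded_linear T"
  shows "(\<lambda>x. T (f x)) \<in> bcontfun"
  using assms unfolding bcontfun_def
  by (auto intro: bounded_linear.continuous_on bounded_linear_image simp: image_image[symmetric])

lemma bcontfun_sum:
  fixes f :: "'i \<Rightarrow> 'k::topological_space \<Rightarrow> complex"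
  assumes "\<And>i. i \<in> I \<Longrightarrow> f i \<in> bcontfun"
  shows "(\<lambda>x. \<Sum>i\<in>I. f i x) \<in> bcontfun"
  using assms by (induction I rule: infinite_finite_induct) (auto intro: const_bcontfun plus_cont)

lemma apply_in_bcontfun: "apply_bcontfun f \<in> bcontfun"
  by (rule apply_bcontfun)

section \<open>Norm bounds from explicit series\<close>

text \<open>Pointwise majorants dominate the supremum norms of the wrapped factors, so termwise
  comparison applies. Later series can thus be given by plain functions and convenient bounds
  instead of exact norms.\<close>

lemma tensor_boundI:
  fixes f g :: "nat \<Rightarrow> 'k::t2_space \<Rightarrow> complex"
  assumes f: "\<And>n. f n \<in> bcontfun" "\<And>n x. norm (f n x) \<le> B n"
    and g: "\<And>n. g n \<in> bcontfun" "\<And>n x. norm (g n x) \<le> C n"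
    and BC: "(\<lambda>n. B n * C n) sums s"
    and F: "\<And>x y. (\<lambda>n. f n x * g n y) sums F (x, y)"
  shows "tensor_bound F s"
proof -
  let ?a = "\<lambda>n. Bcontfun (f n)" and ?b = "\<lambda>n. Bcontfun (g n)"
  have app: "apply_bcontfun (?a n) = f n" "apply_bcontfun (?b n) = g n" for n
    using f g by (simp_all add: Bcontfun_inverse)
  have le: "norm (?a n) * norm (?b n) \<le> B n * C n" for n
  proof (rule mult_mono)
    show "norm (?a n) \<le> B n" "norm (?b n) \<le> C n"
      using f g by (auto intro!: norm_bound simp: app)
    \<comment> \<open>Any point of the nonempty type will do: a bound on a norm is
      nonnegative.\<close>
    show "0 \<le> B n" using f(2)[of n undefined] norm_ge_zero order_trans by meson
  qed auto
  have sm: "summable (\<lambda>n. norm (?a n) * norm (?b n))"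
    by (rule summable_comparison_test'[OF sums_summable[OF BC], of 0]) (use le in auto)
  have "(\<Sum>n. norm (?a n) * norm (?b n)) \<le> (\<Sum>n. B n * C n)"
    by (rule suminf_le[OF le sm sums_summable[OF BC]])
  moreover have "tensor_rep ?a ?b F"
    using sm F by (simp add: tensor_rep_def app)
  ultimately show ?thesis
    unfolding tensor_bound_def sums_unique[OF BC] by blast
qed

lemma tensor_boundE:
  fixes F :: "'k::t2_space \<times> 'k \<Rightarrow> complex"
  assumes "tensor_bound F s"
  obtains a b :: "nat \<Rightarrow> 'k \<Rightarrow>\<^sub>C complex"
  where "tensor_rep a b F" "(\<Sum>n. norm (a n) * norm (b n)) \<le> s"
  using assms unfolding tensor_bound_def by blast

lemma varopoulos_iff: "F \<in> varopoulos \<longleftrightarrow> (\<exists>s. tensor_bound F s)"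
  unfolding varopoulos_def tensor_bound_def by blast

lemma tensor_bound_mono: "tensor_bound F s \<Longrightarrow> s \<le> t \<Longrightarrow> tensor_bound F t"
  unfolding tensor_bound_def by (meson order_trans)

lemma varopoulos_norm_le:
  assumes "tensor_bound F s"
  shows "varopoulos_norm F \<le> s"
proof -
  obtain a b where ab: "tensor_rep a b F" "(\<Sum>n. norm (a n) * norm (b n)) \<le> s"
    using assms by (rule tensor_boundE)
  have "varopoulos_norm F \<le> (\<Sum>n. norm (a n) * norm (b n))"
    unfolding varopoulos_norm_def
  proof (rule cInf_lower)
    show "bdd_below {\<Sum>n. norm (a n) * norm (b n) | a b. tensor_rep a b F}"
      by (rule bdd_belowI[of _ 0]) (auto simp: tensor_rep_def intro!: suminf_nonneg)
  qed (use ab in auto)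
  with ab show ?thesis by simp
qed

text \<open>Every representing series dominates its pointwise sum by its mass, hence so does the
  infimum. This makes point evaluations continuous, which is what closes the diagonal ideal.\<close>

lemma norm_le_varopoulos_norm:
  fixes F :: "'k::t2_space \<times> 'k \<Rightarrow> complex"
  assumes "F \<in> varopoulos"
  shows "norm (F (x, y)) \<le> varopoulos_norm F"
  unfolding varopoulos_norm_def
proof (rule cInf_greatest)
  show "{\<Sum>n. norm (a n) * norm (b n) | a b. tensor_rep a b F} \<noteq> {}"
    using assms by (auto simp: varopoulos_def)
next
  fix s assume "s \<in> {\<Sum>n. norm (a n) * norm (b n) | a b. tensor_rep a b F}"
  then obtain a b where s: "s = (\<Sum>n. norm (a n) * norm (b n))" and rep: "tensor_rep a b F" by blast
  have "norm (\<Sum>n. apply_bcontfun (a n) x * apply_bcontfun (b n) y) \<le> s"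
    unfolding s using rep
    by (intro norm_suminf_le) (auto simp: tensor_rep_def norm_mult intro!: mult_mono norm_bounded)
  then show "norm (F (x, y)) \<le> s" using rep by (auto simp: tensor_rep_def sums_iff)
qed

lemma tensor_bound_elementary:
  fixes f g :: "'k::t2_space \<Rightarrow> complex"
  assumes f: "f \<in> bcontfun" "\<And>x. norm (f x) \<le> B" and g: "g \<in> bcontfun" "\<And>x. norm (g x) \<le> C"
  shows "tensor_bound (\<lambda>(x, y). f x * g y) (B * C)"
proof -
  \<comment> \<open>An elementary tensor is a series with its only term at index 0; cutting off the
    left factor and its bound is enough.\<close>
  have "(\<lambda>n. (if n = 0 then B else 0) * C) sums (B * C)"
    using sums_finite[of "{0}" "\<lambda>n. (if n = 0 then B else 0) * C"] by simp
  moreover have "(\<lambda>n. (if n = 0 then f else (\<lambda>_. 0)) x * g y) sums (f x * g y)" for x y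
    using sums_finite[of "{0}" "\<lambda>n. (if n = 0 then f else (\<lambda>_. 0)) x * g y"] by simp
  ultimately show ?thesis using f g
    by (intro tensor_boundI[where f = "\<lambda>n. if n = 0 then f else (\<lambda>_. 0)" and g = "\<lambda>_. g" and B = "\<lambda>n. if n = 0 then B else 0" and C = "\<lambda>_. C"])
      (auto simp: const_bcontfun)
qed

lemma sums_if_complex:
  fixes f g :: "nat \<Rightarrow> complex"
  assumes "g sums x" "f sums y"
  shows "(\<lambda>n. if even n then f (n div 2) else g ((n - 1) div 2)) sums (x + y)"
  using assms sums_if[of "\<lambda>n. Re (g n)" "Re x" "\<lambda>n. Re (f n)" "Re y"]
    sums_if[of "\<lambda>n. Im (g n)" "Im x" "\<lambda>n. Im (f n)" "Im y"]
  by (simp add: sums_complex_iff if_distrib[of Re] if_distrib[of Im])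

text \<open>The two series are interleaved, \<open>G\<close> on the even and \<open>F\<close> on the
  odd indices, so the masses add.\<close>

lemma tensor_bound_add:
  assumes "tensor_bound F s" "tensor_bound G t"
  shows "tensor_bound (\<lambda>p. F p + G p) (s + t)"
proof -
  obtain a b where F: "tensor_rep a b F" and s: "(\<Sum>n. norm (a n) * norm (b n)) \<le> s"
    using assms(1) by (rule tensor_boundE)
  obtain a' b' where G: "tensor_rep a' b' G" and t: "(\<Sum>n. norm (a' n) * norm (b' n)) \<le> t"
    using assms(2) by (rule tensor_boundE)
  let ?mix = "\<lambda>u v n. if even n then u (n div 2) else v ((n - 1) div 2)"
  have mix: "(\<lambda>n. h (?mix a' a n) (?mix b' b n)) =
      (\<lambda>n. if even n then h (a' (n div 2)) (b' (n div 2)) else h (a ((n - 1) div 2)) (b ((n - 1) div 2)))"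
    for h :: "_ \<Rightarrow> _ \<Rightarrow> 'x" by auto
  have "(\<lambda>n. norm (?mix a' a n) * norm (?mix b' b n)) sums
      ((\<Sum>n. norm (a n) * norm (b n)) + (\<Sum>n. norm (a' n) * norm (b' n)))"
    unfolding mix[of "\<lambda>u v. norm u * norm v"]
    using F G by (intro sums_if) (auto simp: tensor_rep_def)
  moreover have "(\<lambda>n. ?mix a' a n x * ?mix b' b n y) sums (F (x, y) + G (x, y))" for x y
    unfolding mix[of "\<lambda>u v. apply_bcontfun u x * apply_bcontfun v y"]
    using F G by (intro sums_if_complex) (auto simp: tensor_rep_def)
  ultimately have "tensor_bound (\<lambda>p. F p + G p)
      ((\<Sum>n. norm (a n) * norm (b n)) + (\<Sum>n. norm (a' n) * norm (b' n)))"
    by (intro tensor_boundI[where f = "\<lambda>n. apply_bcontfun (?mix a' a n)" and g = "\<lambda>n. apply_bcontfun (?mix b' b n)"])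
      (auto intro: apply_in_bcontfun norm_bounded)
  then show ?thesis by (rule tensor_bound_mono) (use s t in simp)
qed

section \<open>Algebra operations on the Varopoulos algebra\<close>

lemma varopoulos_add: "F \<in> varopoulos \<Longrightarrow> G \<in> varopoulos \<Longrightarrow> (\<lambda>p. F p + G p) \<in> varopoulos"
  unfolding varopoulos_iff using tensor_bound_add by blast

lemma varopoulos_elementary:
  assumes "f \<in> bcontfun" "g \<in> bcontfun"
  shows "(\<lambda>(x, y). f x * g y) \<in> varopoulos"
proof -
  obtain B where "B > 0" "\<And>x. norm (f x) \<le> B" using bcontfun_bounded[OF assms(1)] by blast
  moreover obtain C where "C > 0" "\<And>x. norm (g x) \<le> C" using bcontfun_bounded[OF assms(2)] by blast
  ultimately have "tensor_bound (\<lambda>(x, y). f x * g y) (B * C)"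
    using assms by (intro tensor_bound_elementary)
  then show ?thesis unfolding varopoulos_iff by blast
qed

text \<open>Multiplying the two series gives a double series of elementary tensors whose masses
  \<open>N i * M j\<close> are summable; \<open>prod_decode\<close> enumerates it as a single
  series.\<close>

lemma varopoulos_mult:
  fixes F G :: "'k::t2_space \<times> 'k \<Rightarrow> complex"
  assumes "F \<in> varopoulos" "G \<in> varopoulos"
  shows "(\<lambda>p. F p * G p) \<in> varopoulos"
proof -
  obtain a b a' b' where F: "tensor_rep a b F" and G: "tensor_rep a' b' G"
    using assms by (auto simp: varopoulos_def)
  define N where "N i = norm (a i) * norm (b i)" for i
  define M where "M j = norm (a' j) * norm (b' j)" for j
  have smN: "summable N" and smM: "summable M"
    using F G by (auto simp: tensor_rep_def N_def[abs_def] M_def[abs_def])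
  have NM0: "N i \<ge> 0" "M j \<ge> 0" for i j by (auto simp: N_def M_def)
  have N: "N summable_on UNIV" and M: "M summable_on UNIV"
    using smN smM NM0 by (simp_all add: summable_on_UNIV_nonneg_real_iff)
  have NM': "(\<lambda>p. norm (case p of (i, j) \<Rightarrow> N i * M j)) summable_on UNIV"
    using N M NM0 infsum_nonneg[of UNIV M]
    unfolding Infinite_Sum.abs_summable_on_Sigma_iff UNIV_Times_UNIV[symmetric]
    by (simp add: abs_mult summable_on_cmult_right summable_on_cmult_left infsum_cmult_right')
  then have NM: "(\<lambda>(i, j). N i * M j) summable_on UNIV"
    using NM0 by (simp add: case_prod_unfold)
  let ?u = "\<lambda>(i, j) x. apply_bcontfun (a i) x * apply_bcontfun (a' j) x"
  let ?v = "\<lambda>(i, j) y. apply_bcontfun (b i) y * apply_bcontfun (b' j) y"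
  have "((\<lambda>p. ?u p x * ?v p y) has_sum F (x, y) * G (x, y)) UNIV" for x y
  proof -
    let ?t = "\<lambda>i. apply_bcontfun (a i) x * b i y" and ?t' = "\<lambda>j. apply_bcontfun (a' j) x * b' j y"
    have le: "norm (?t i) \<le> N i" "norm (?t' j) \<le> M j" for i j
      by (auto simp: N_def M_def norm_mult intro!: mult_mono norm_bounded)
    have ts: "(?t has_sum F (x, y)) UNIV"
      by (rule norm_summable_imp_has_sum[OF summable_comparison_test'[OF smN, of 0]])
        (use le F in \<open>auto simp: tensor_rep_def\<close>)
    have ts': "(?t' has_sum G (x, y)) UNIV"
      by (rule norm_summable_imp_has_sum[OF summable_comparison_test'[OF smM, of 0]])
        (use le G in \<open>auto simp: tensor_rep_def\<close>)
    have "norm (?t i * ?t' j) \<le> norm (N i * M j)" for i j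
      unfolding norm_mult[of "?t i"] real_norm_def abs_mult abs_of_nonneg[OF NM0(1)] abs_of_nonneg[OF NM0(2)]
      using NM0 by (intro mult_mono le) auto
    then have "(\<lambda>(i, j). ?t i * ?t' j) summable_on UNIV"
      by (auto intro: abs_summable_summable[OF Infinite_Sum.abs_summable_on_comparison_test[OF NM']])
    \<comment> \<open>Absolute convergence permits iterated summation: the inner sum over
      \<open>j\<close> is \<open>?t i * G (x, y)\<close>, and the outer sum then produces
      \<open>F (x, y)\<close>.\<close>
    then have "((\<lambda>(i, j). ?t i * ?t' j) has_sum F (x, y) * G (x, y)) (UNIV \<times> UNIV)"
      using has_sum_cmult_right[OF ts'] has_sum_cmult_left[OF ts]
      by (intro has_sum_SigmaI[where g = "\<lambda>i. ?t i * G (x, y)"]) auto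
    then show ?thesis by (simp add: case_prod_unfold mult_ac)
  qed
  then have "((\<lambda>n. ?u (prod_decode n) x * ?v (prod_decode n) y) has_sum F (x, y) * G (x, y)) UNIV" for x y
    by (subst has_sum_reindex_bij_betw[OF bij_prod_decode])
  then have sums: "(\<lambda>n. ?u (prod_decode n) x * ?v (prod_decode n) y) sums (F (x, y) * G (x, y))" for x y
    by (rule has_sum_imp_sums)
  let ?B = "\<lambda>(i, j). norm (a i) * norm (a' j)" and ?C = "\<lambda>(i, j). norm (b i) * norm (b' j)"
  have "(\<lambda>p. ?B p * ?C p) summable_on UNIV"
    using NM by (simp add: N_def M_def case_prod_unfold mult_ac)
  then have "(\<lambda>n. ?B (prod_decode n) * ?C (prod_decode n)) summable_on UNIV"
    by (subst summable_on_reindex_bij_betw[OF bij_prod_decode])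
  then obtain s where "(\<lambda>n. ?B (prod_decode n) * ?C (prod_decode n)) sums s"
    using summable_on_imp_summable summable_def by blast
  from this sums have "tensor_bound (\<lambda>p. F p * G p) s"
    by (intro tensor_boundI[where f = "\<lambda>n. ?u (prod_decode n)" and g = "\<lambda>n. ?v (prod_decode n)" and
          B = "\<lambda>n. ?B (prod_decode n)" and C = "\<lambda>n. ?C (prod_decode n)"])
      (auto simp: norm_mult case_prod_unfold intro!: mult_mono norm_bounded bcontfun_mult apply_in_bcontfun)
  then show ?thesis by (auto simp: varopoulos_iff)
qed

lemma varopoulos_scale:
  assumes "F \<in> varopoulos"
  shows "(\<lambda>p. c * F p) \<in> varopoulos"
  \<comment> \<open>Scaling is multiplication by the elementary tensor of the constants
    \<open>c\<close> and 1.\<close>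
  using varopoulos_mult[OF varopoulos_elementary[OF const_bcontfun[of c] const_bcontfun[of 1]] assms]
  by (simp add: case_prod_unfold)

lemma varopoulos_diff:
  assumes "F \<in> varopoulos" "G \<in> varopoulos"
  shows "(\<lambda>p. F p - G p) \<in> varopoulos"
  using varopoulos_add[OF assms(1) varopoulos_scale[OF assms(2), of "-1"]] by simp

lemma difference_fun_varopoulos: "difference_fun f \<in> varopoulos"
proof -
  have "(\<lambda>p. (\<lambda>(x, y). apply_bcontfun f x * 1) p - (\<lambda>(x, y). 1 * apply_bcontfun f y) p) \<in> varopoulos"
    by (intro varopoulos_diff varopoulos_elementary apply_in_bcontfun const_bcontfun)
  then show ?thesis by (simp add: difference_fun_def case_prod_unfold)
qed

section \<open>The diagonal ideal\<close>

text \<open>Closedness is the point with content: the value at \<open>(x, x)\<close> of a limit is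
  bounded by the norm distance to approximants that vanish there.\<close>

lemma diagonal_ideal_closed_subalgebra:
  "varopoulos_closed_subalgebra {F \<in> varopoulos. \<forall>x. F (x, x) = 0}"
  unfolding varopoulos_closed_subalgebra_def
proof (intro conjI ballI allI impI)
  show "(\<lambda>p. 0) \<in> {F \<in> varopoulos. \<forall>x. F (x, x) = 0}"
    using varopoulos_elementary[OF const_bcontfun[of 0] const_bcontfun[of 0]]
    by (simp add: case_prod_unfold)
next
  fix F :: "'a \<times> 'a \<Rightarrow> complex"
  assume F: "F \<in> varopoulos" and
    approx: "\<forall>e>0. \<exists>G\<in>{F \<in> varopoulos. \<forall>x. F (x, x) = 0}. varopoulos_norm (\<lambda>p. F p - G p) < e"
  have "norm (F (x, x)) \<le> e" if "e > 0" for x e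
  proof -
    obtain G where G: "G \<in> varopoulos" "G (x, x) = 0" "varopoulos_norm (\<lambda>p. F p - G p) < e"
      using approx \<open>e > 0\<close> by blast
    then show ?thesis
      using norm_le_varopoulos_norm[OF varopoulos_diff[OF F G(1)], of x x] by simp
  qed
  then have "norm (F (x, x)) \<le> 0" for x
    by (rule field_le_epsilon) simp
  then have "F (x, x) = 0" for x by simp
  with F show "F \<in> {F \<in> varopoulos. \<forall>x. F (x, x) = 0}" by simp
qed (auto intro: varopoulos_add varopoulos_scale varopoulos_mult)

section \<open>Closed subalgebras containing the differences\<close>

text \<open>An arbitrary competitor for the hull; the context ends by showing that it contains the
  diagonal ideal.\<close>

locale difference_subalgebra =
  fixes A :: "('k::t2_space \<times> 'k \<Rightarrow> complex) set"
  assumes closed_subalgebra: "varopoulos_closed_subalgebra A"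
    and difference_mem: "range difference_fun \<subseteq> A"
begin

lemma
  shows zero: "(\<lambda>p. 0) \<in> A"
    and add: "F \<in> A \<Longrightarrow> G \<in> A \<Longrightarrow> (\<lambda>p. F p + G p) \<in> A"
    and scale: "F \<in> A \<Longrightarrow> (\<lambda>p. c * F p) \<in> A"
    and mult: "F \<in> A \<Longrightarrow> G \<in> A \<Longrightarrow> (\<lambda>p. F p * G p) \<in> A"
    and subset_varopoulos: "A \<subseteq> varopoulos"
  using closed_subalgebra unfolding varopoulos_closed_subalgebra_def by blast+

lemma diff: "F \<in> A \<Longrightarrow> G \<in> A \<Longrightarrow> (\<lambda>p. F p - G p) \<in> A"
  using add[OF _ scale[of G "-1"], of F] by simp

lemma sum: "(\<And>i. i \<in> I \<Longrightarrow> F i \<in> A) \<Longrightarrow> (\<lambda>p. \<Sum>i\<in>I. F i p) \<in> A"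
  by (induction I rule: infinite_finite_induct) (auto intro: zero add)

lemma closed:
  assumes "\<And>e. e > 0 \<Longrightarrow> \<exists>G\<in>A. \<exists>s<e. tensor_bound (\<lambda>p. F p - G p) s"
  shows "F \<in> A"
proof -
  \<comment> \<open>One approximant, here for \<open>e = 1\<close>, already places
    \<open>F = (F - G) + G\<close> in the Varopoulos algebra.\<close>
  obtain G s where G: "G \<in> A" "tensor_bound (\<lambda>p. F p - G p) s"
    using assms[of 1] by auto
  have "(\<lambda>p. (F p - G p) + G p) \<in> varopoulos"
    using G subset_varopoulos by (intro varopoulos_add) (auto simp: varopoulos_iff)
  then have "F \<in> varopoulos" by simp
  moreover have "\<exists>G\<in>A. varopoulos_norm (\<lambda>p. F p - G p) < e" if "e > 0" for e
    using assms[OF that] varopoulos_norm_le by (metis order_le_less_trans)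
  ultimately show ?thesis
    using closed_subalgebra unfolding varopoulos_closed_subalgebra_def by blast
qed

lemma difference: "f \<in> bcontfun \<Longrightarrow> (\<lambda>(x, y). f x - f y) \<in> A"
  using difference_mem by (auto simp: difference_fun_def elim!: bcontfunE)

section \<open>Multiplying differences by functions of the second variable\<close>

text \<open>A Leibniz rule for \<open>f * g\<close>. It yields the two module products only in sum;
  the next lemma separates them at the cost of an extra difference factor.\<close>

lemma difference_symmetric:
  assumes "f \<in> bcontfun" "g \<in> bcontfun"
  shows "(\<lambda>(x, y). (f x - f y) * g y + (g x - g y) * f y) \<in> A"
proof -
  have "(\<lambda>p. (\<lambda>(x, y). f x * g x - f y * g y) p - (\<lambda>(x, y). f x - f y) p * (\<lambda>(x, y). g x - g y) p) \<in> A"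
    using assms by (intro diff mult difference bcontfun_mult)
  also have "(\<lambda>p. (\<lambda>(x, y). f x * g x - f y * g y) p - (\<lambda>(x, y). f x - f y) p * (\<lambda>(x, y). g x - g y) p)
    = (\<lambda>(x, y). (f x - f y) * g y + (g x - g y) * f y)"
    by (auto simp: fun_eq_iff algebra_simps)
  finally show ?thesis .
qed

lemma difference_difference:
  assumes "f \<in> bcontfun" "h \<in> bcontfun" "g \<in> bcontfun"
  shows "(\<lambda>(x, y). (f x - f y) * (h x - h y) * g y) \<in> A"
proof -
  let ?d = "\<lambda>f (x, y). f x - f y" and ?s = "\<lambda>f g (x, y). (f x - f y) * g y + (g x - g y) * f y"
  \<comment> \<open>each product \<open>?d h * ?s f g\<close> is a sum of two of the three elements
    that arise by permuting \<open>f\<close>, \<open>h\<close>, \<open>g\<close>\<close>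
  have "(\<lambda>p. 1 / 2 * (?d h p * ?s f g p + ?d f p * ?s h g p - ?d g p * ?s f h p)) \<in> A"
    using assms by (intro scale diff add mult difference difference_symmetric)
  also have "(\<lambda>p. 1 / 2 * (?d h p * ?s f g p + ?d f p * ?s h g p - ?d g p * ?s f h p))
    = (\<lambda>(x, y). (f x - f y) * (h x - h y) * g y)"
    by (auto simp: fun_eq_iff field_simps)
  finally show ?thesis .
qed

text \<open>Averaging removes the extra factor: multiplied by \<open>cnj (w y) ^ k\<close>, the
  difference of \<open>w ^ k\<close> becomes \<open>z ^ k - 1\<close>, and \<open>1 - z\<close>
  times the mean of the \<open>z ^ k\<close> telescopes. Unimodularity makes
  \<open>cnj (w y)\<close> the inverse of \<open>w y\<close> and keeps all powers bounded by
  1.\<close>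

lemma difference_unimodular:
  assumes w: "w \<in> bcontfun" "\<And>x. norm (w x) = 1" and g: "g \<in> bcontfun"
  shows "(\<lambda>(x, y). (w x - w y) * g y) \<in> A"
proof (rule closed)
  fix e :: real assume "e > 0"
  obtain C where C: "C > 0" "\<And>x. norm (g x) \<le> C" using bcontfun_bounded[OF g] by blast
  \<comment> \<open>The error will consist of two elementary tensors of norm at most
    \<open>C / N\<close> each.\<close>
  obtain N where N: "real N > 2 * C / e" using reals_Archimedean2 by blast
  then have N0: "N > 0" using C \<open>e > 0\<close> by (metis divide_pos_pos gr0I mult_pos_pos of_nat_0 order_less_asym zero_less_numeral)
  have cw: "(\<lambda>x. cnj (w x)) \<in> bcontfun"
    by (rule bcontfun_bounded_linear[OF w(1) bounded_linear_cnj])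
  have wc: "w x * cnj (w x) = 1" for x
    using w(2)[of x] by (simp add: complex_norm_square[symmetric])
  define c :: complex where "c = 1 / of_nat N"
  have cN: "c * of_nat N = 1" using N0 by (simp add: c_def)
  \<comment> \<open>The terms come from \<open>difference_difference\<close> with
    \<open>h = w ^ k\<close> and the weight \<open>cnj w ^ k * g\<close>. The sign turns the
    \<open>- 1\<close> in \<open>z ^ k - 1\<close> into the wanted function.\<close>
  let ?G = "\<lambda>p. - c * (\<Sum>k<N. (\<lambda>(x, y). (w x - w y) * (w x ^ k - w y ^ k) * (cnj (w y) ^ k * g y)) p)"
  have "?G \<in> A"
    by (intro scale sum difference_difference bcontfun_power bcontfun_mult w cw g)
  \<comment> \<open>The remainder \<open>c * w y * g y * (z ^ N - 1)\<close>, written as two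
    elementary tensors so that its norm can be read off.\<close>
  let ?E = "\<lambda>p. (\<lambda>(x, y). w x ^ N * (c * (w y * cnj (w y) ^ N * g y))) p + (\<lambda>(x, y). 1 * (- c * (w y * g y))) p"
  have eq: "(\<lambda>p. (\<lambda>(x, y). (w x - w y) * g y) p - ?G p) = ?E"
  proof
    fix p :: "'k \<times> 'k"
    obtain x y where p: "p = (x, y)" by (rule prod.exhaust)
    define z where "z = w x * cnj (w y)"
    have wz: "w x = w y * z"
      using wc[of y] unfolding z_def by algebra
    have zk: "(w x ^ k - w y ^ k) * cnj (w y) ^ k = z ^ k - 1" for k
    proof -
      have "(w x ^ k - w y ^ k) * cnj (w y) ^ k = (w x * cnj (w y)) ^ k - (w y * cnj (w y)) ^ k"
        by (simp only: power_mult_distrib left_diff_distrib)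
      then show ?thesis by (simp only: wc z_def power_one)
    qed
    have "(w x - w y) * (w x ^ k - w y ^ k) * (cnj (w y) ^ k * g y) = (w x - w y) * g y * (z ^ k - 1)" for k
      unfolding zk[symmetric] by (simp only: mult_ac)
    then have G: "(\<Sum>k<N. (w x - w y) * (w x ^ k - w y ^ k) * (cnj (w y) ^ k * g y))
        = (w x - w y) * g y * ((\<Sum>k<N. z ^ k) - of_nat N)"
      by (simp only: sum_distrib_left[symmetric] sum_subtractf) simp
    have E: "w x ^ N * (c * (w y * cnj (w y) ^ N * g y)) = c * (w y * g y * z ^ N)"
      by (simp only: z_def power_mult_distrib mult_ac)
    \<comment> \<open>The algebra with letters for \<open>D = w x - w y\<close>,
      \<open>v = w y\<close>, \<open>h = g y\<close>, \<open>n = N\<close>, \<open>t = z ^ N\<close>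
      and the geometric sum \<open>S\<close>: the terms \<open>D * h\<close> cancel by
      \<open>c * n = 1\<close>, and \<open>D * S\<close> collapses to
      \<open>v * t - v\<close>.\<close>
    have telescope: "D * h - - c * (D * h * (S - n)) = c * (v * h * t) + 1 * (- c * (v * h))"
      if "D = v * z - v" "c * n = 1" "1 - t = (1 - z) * S" for D h S n t v
    proof -
      have "D * S = - v * ((1 - z) * S)" by (simp add: that(1) algebra_simps)
      also have "\<dots> = v * t - v" unfolding that(3)[symmetric] by (simp add: algebra_simps)
      finally have DS: "D * S = v * t - v" .
      have "D * h - - c * (D * h * (S - n)) = (1 - c * n) * (D * h) + c * h * (D * S)"
        by (simp add: algebra_simps)
      then show ?thesis unfolding DS that(2) by (simp add: algebra_simps)
    qed
    show "(\<lambda>(x, y). (w x - w y) * g y) p - ?G p = ?E p"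
      unfolding p case_prod_conv G E
    proof (rule telescope)
      show "w x - w y = w y * z - w y" unfolding wz[symmetric] ..
    qed (fact cN one_diff_power_eq)+
  qed
  have "tensor_bound ?E (1 * (C / N) + 1 * (C / N))"
    using C N0 w(2)
    by (intro tensor_bound_add tensor_bound_elementary const_bcontfun bcontfun_mult bcontfun_power w cw g)
      (auto simp: c_def norm_mult norm_power norm_divide divide_right_mono)
  moreover have "1 * (C / N) + 1 * (C / N) < e"
    using N \<open>e > 0\<close> N0 by (simp add: field_simps)
  ultimately show "\<exists>G\<in>A. \<exists>s<e. tensor_bound (\<lambda>p. (\<lambda>(x, y). (w x - w y) * g y) p - G p) s"
    by (intro bexI[OF _ \<open>?G \<in> A\<close>] exI[of _ "1 * (C / N) + 1 * (C / N)"]) (simp only: eq simp_thms)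
qed

text \<open>A real function with values in [-1, 1] is the real part of the unimodular function
  \<open>u + i sqrt (1 - u^2)\<close>, hence half the sum of that function and its conjugate, which
  is unimodular too.\<close>

lemma difference_real:
  assumes u: "continuous_on UNIV u" "\<And>x. \<bar>u x\<bar> \<le> (1 :: real)" and g: "g \<in> bcontfun"
  shows "(\<lambda>(x, y). (complex_of_real (u x) - of_real (u y)) * g y) \<in> A"
proof -
  define w where "w x = Complex (u x) (sqrt (1 - (u x)\<^sup>2))" for x
  have u1: "(u x)\<^sup>2 \<le> 1" for x using u(2)[of x] by (simp add: abs_square_le_1)
  have nw: "norm (w x) = 1" for x using u1[of x] by (simp add: w_def cmod_def)
  have w: "w \<in> bcontfun"
  proof (rule bcontfun_normI[where b = 1])
    show "continuous_on UNIV w"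
      unfolding w_def Complex_eq by (intro continuous_intros u(1))
  qed (simp add: nw)
  have cw: "(\<lambda>x. cnj (w x)) \<in> bcontfun"
    by (rule bcontfun_bounded_linear[OF w bounded_linear_cnj])
  have cnj: "cnj (w x) = 2 * of_real (u x) - w x" for x
    by (simp add: complex_eq_iff w_def)
  have "(\<lambda>p. 1 / 2 * ((\<lambda>(x, y). (w x - w y) * g y) p + (\<lambda>(x, y). (cnj (w x) - cnj (w y)) * g y) p)) \<in> A"
    by (intro scale add difference_unimodular w cw g) (simp_all add: nw)
  also have "(\<lambda>p. 1 / 2 * ((\<lambda>(x, y). (w x - w y) * g y) p + (\<lambda>(x, y). (cnj (w x) - cnj (w y)) * g y) p))
    = (\<lambda>(x, y). (complex_of_real (u x) - of_real (u y)) * g y)"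
    by (auto simp: fun_eq_iff cnj field_simps)
  finally show ?thesis .
qed

text \<open>Dividing by a bound \<open>B\<close> brings the real and imaginary parts into [-1, 1];
  they are recombined with the coefficients \<open>B\<close> and \<open>i B\<close>.\<close>

lemma difference_module:
  assumes f: "f \<in> bcontfun" and g: "g \<in> bcontfun"
  shows "(\<lambda>(x, y). (f x - f y) * g y) \<in> A"
proof -
  obtain B where B: "B > 0" "\<And>x. norm (f x) \<le> B" using bcontfun_bounded[OF f] by blast
  let ?d = "\<lambda>u (x, y). (complex_of_real (u x) - of_real (u y)) * g y"
  let ?r = "\<lambda>x. Re (f x) / B" and ?i = "\<lambda>x. Im (f x) / B"
  have "\<bar>?r x\<bar> \<le> 1" "\<bar>?i x\<bar> \<le> 1" for x
    using B abs_Re_le_cmod[of "f x"] abs_Im_le_cmod[of "f x"]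
    by (simp_all add: abs_divide divide_le_eq order_trans[OF _ B(2)])
  then have "?d ?r \<in> A" "?d ?i \<in> A"
    using B(1) by (auto intro!: difference_real g continuous_intros bcontfun_continuous[OF f] simp del: of_real_divide)
  then have "(\<lambda>p. of_real B * ?d ?r p + \<i> * of_real B * ?d ?i p) \<in> A"
    by (intro add scale)
  also have "(\<lambda>p. of_real B * ?d ?r p + \<i> * of_real B * ?d ?i p) = (\<lambda>(x, y). (f x - f y) * g y)"
    using B(1) by (auto simp: fun_eq_iff complex_eq_iff field_simps)
  finally show ?thesis .
qed

section \<open>Approximating a function that vanishes on the diagonal\<close>

text \<open>The rewritten series of terms \<open>(a n x - a n y) * b n y\<close> is truncated. The
  error is the tail of the given series plus the truncated diagonal sum, both small.\<close>

lemma diagonal_ideal_subset: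
  assumes F: "F \<in> varopoulos" and diag: "\<And>x. F (x, x) = 0"
  shows "F \<in> A"
proof (rule closed)
  fix e :: real assume "e > 0"
  obtain a b where rep: "tensor_rep a b F" using F by (auto simp: varopoulos_def)
  define M where "M n = norm (a n) * norm (b n)" for n
  have M: "summable M" and sums: "\<And>x y. (\<lambda>n. a n x * b n y) sums F (x, y)"
    using rep by (auto simp: tensor_rep_def M_def[abs_def])
  \<comment> \<open>Half of \<open>e\<close>, since the tail mass enters twice: through
    \<open>?T\<close> and through \<open>?c\<close>.\<close>
  obtain N where N: "norm (\<Sum>n. M (n + N)) < e / 2"
    using suminf_exist_split[OF _ M, of "e / 2"] \<open>e > 0\<close> by auto
  define s where "s = (\<Sum>n. M (n + N))"
  let ?G = "\<lambda>p. \<Sum>n<N. (\<lambda>(x, y). (a n x - a n y) * b n y) p"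
  let ?c = "\<lambda>y. \<Sum>n<N. a n y * b n y"
  let ?T = "\<lambda>(x, y). \<Sum>n. a (n + N) x * b (n + N) y"
  have split: "(\<lambda>n. a (n + N) x * b (n + N) y) sums (F (x, y) - (\<Sum>n<N. a n x * b n y))" for x y
    using sums by (rule sums_split_initial_segment)
  have mass: "(\<lambda>n. norm (a (n + N)) * norm (b (n + N))) sums s"
    using summable_sums[OF summable_ignore_initial_segment[OF M, of N]] by (simp only: s_def M_def)
  have tail: "tensor_bound ?T s"
    by (rule tensor_boundI[where f = "\<lambda>n. apply_bcontfun (a (n + N))" and g = "\<lambda>n. apply_bcontfun (b (n + N))"
          and B = "\<lambda>n. norm (a (n + N))" and C = "\<lambda>n. norm (b (n + N))"])
      (use mass summable_sums[OF sums_summable[OF split]] in \<open>auto intro: apply_in_bcontfun norm_bounded\<close>)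
  \<comment> \<open>as \<open>F\<close> vanishes on the diagonal, \<open>?c\<close> is minus a tail of the series \<open>\<Sum>n. a n y * b n y\<close>\<close>
  have "norm (?c y) \<le> s" for y
  proof -
    have "?c y = - ?T (y, y)" using split[of y y] diag by (simp add: sums_iff)
    moreover have "norm (?T (y, y)) \<le> s"
      unfolding sums_unique[OF mass] case_prod_conv
      by (rule norm_suminf_le[OF _ sums_summable[OF mass]])
        (auto simp: norm_mult intro!: mult_mono norm_bounded)
    ultimately show ?thesis by simp
  qed
  \<comment> \<open>The correction depends on \<open>y\<close> alone, so it is one elementary tensor
    and its supremum bound suffices.\<close>
  then have "tensor_bound (\<lambda>(x, y). 1 * ?c y) (1 * s)"
    by (intro tensor_bound_elementary const_bcontfun bcontfun_sum bcontfun_mult apply_in_bcontfun) auto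
  from tensor_bound_add[OF tail this]
  have "tensor_bound (\<lambda>p. ?T p + (\<lambda>(x, y). 1 * ?c y) p) (s + s)" by simp
  also have "(\<lambda>p. ?T p + (\<lambda>(x, y). 1 * ?c y) p) = (\<lambda>p. F p - ?G p)"
    using split by (auto simp: fun_eq_iff sums_iff sum_subtractf left_diff_distrib)
  finally have "tensor_bound (\<lambda>p. F p - ?G p) (s + s)" .
  moreover have "s + s < e" using N by (simp add: s_def)
  moreover have "?G \<in> A" by (intro sum difference_module apply_in_bcontfun)
  ultimately show "\<exists>G\<in>A. \<exists>s<e. tensor_bound (\<lambda>p. F p - G p) s"
    by (intro bexI[of _ ?G] exI[of _ "s + s"] conjI)
qed

end

section \<open>The generated closed subalgebra\<close>

theorem theorem3p3:
  assumes "compact (UNIV :: 'k::t2_space set)"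
  shows "varopoulos_closed_subalgebra hull (range (difference_fun :: ('k \<Rightarrow>\<^sub>C complex) \<Rightarrow> _)) =
    {F \<in> varopoulos. \<forall>x. F (x, x) = 0}"
proof (rule hull_unique)
  show "range (difference_fun :: ('k \<Rightarrow>\<^sub>C complex) \<Rightarrow> _) \<subseteq> {F \<in> varopoulos. \<forall>x. F (x, x) = 0}"
    using difference_fun_varopoulos by (auto simp: difference_fun_def)
next
  fix A :: "('k \<times> 'k \<Rightarrow> complex) set"
  assume "range difference_fun \<subseteq> A" "varopoulos_closed_subalgebra A"
  then interpret difference_subalgebra A by unfold_locales
  show "{F \<in> varopoulos. \<forall>x. F (x, x) = 0} \<subseteq> A"
    using diagonal_ideal_subset by blast
qed (rule diagonal_ideal_closed_subalgebra)

end
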